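(* Let $f:\mathbb{N}\to[0,\infty)$ be a nondecreasing function. The following are equivalent. (i) For every non-ultimately periodic infinite word $\mathbf{x}$ over a finite alphabet, $$\frac{f(\operatorname{Pal}_{\mathbf{x}}(n))}{\rho_{\mathbf{x}}(n)}\to 0 \quad\text{as } n\to\infty.$$ (ii) $f(t)=O(t\log(t+1))$ as $t\to\infty$. Moreover, if $f(t)/(t\log(t+1))$ is unbounded (over integers $t\ge 1$), then there exists a non-ultimately periodic infinite word $\mathbf{x}$ over a finite alphabet for which $$\limsup_{n\to\infty}\frac{f(\operatorname{Pal}_{\mathbf{x}}(n))}{\rho_{\mathbf{x}}(n)}=+\infty.$$
   Context: $\mathbb{N}=\{0,1,2,\ldots\}$. An infinite word $\mathbf{x} = (a_i)_{i\ge 0}$ over a finite alphabet $\Sigma$ is a sequence of elements of $\Sigma$ indexed by the nonnegative integers. It is ultimately periodic if there are $T\ge 1$ and $N\ge 0$ with $a_{i+T}=a_i$ for all $i\ge N$. A length-$n$ factor of $\mathbf{x}$ is a finite word of the form $a_i a_{i+1}\cdots a_{i+n-1}$ for some $i\ge 0$. The factor complexity $\rho_{\mathbf{x}}(n)$ is the number of distinct length-$n$ factors of $\mathbf{x}$. A finite word is a palindrome if it equals its reversal. The palindrome complexity $\operatorname{Pal}_{\mathbf{x}}(n)$ is the number of distinct length-$n$ factors of $\mathbf{x}$ that are palindromes. Here $\log$ is the natural logarithm. *)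

theory Defs
  imports "HOL-Analysis.Analysis" "HOL-Library.Landau_Symbols"
begin

definition ultimately_periodic :: "(nat \<Rightarrow> 'a) \<Rightarrow> bool" where
  "ultimately_periodic x \<longleftrightarrow> (\<exists>T\<ge>1. \<exists>N. \<forall>i\<ge>N. x (i + T) = x i)"

definition factors :: "(nat \<Rightarrow> 'a) \<Rightarrow> nat \<Rightarrow> 'a list set" where
  "factors x n = range (\<lambda>i. map x [i..<i + n])"

definition palindrome :: "'a list \<Rightarrow> bool" where
  "palindrome w \<longleftrightarrow> rev w = w"

text \<open>
  The following two counts are meaningful for words over a finite alphabet, where
  \<open>factors x n\<close> is finite: \<^const>\<open>card\<close> of an infinite set is 0.
\<close>

definition factor_complexity :: "(nat \<Rightarrow> 'a) \<Rightarrow> nat \<Rightarrow> nat" where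
  "factor_complexity x n = card (factors x n)"

definition palindrome_complexity :: "(nat \<Rightarrow> 'a) \<Rightarrow> nat \<Rightarrow> nat" where
  "palindrome_complexity x n = card {w \<in> factors x n. palindrome w}"

lemma finite_factors:
  assumes "finite A" "range x \<subseteq> A"
  shows "finite (factors x n)"
proof (rule finite_subset)
  show "factors x n \<subseteq> {w. set w \<subseteq> A \<and> length w = n}"
    using assms(2) unfolding factors_def image_subset_iff by auto
  show "finite {w. set w \<subseteq> A \<and> length w = n}"
    using assms(1) by (rule finite_lists_length_eq)
qed

text \<open>
  All the notions above are invariant under injective renaming of letters. As a formula cannot
  quantify over types, ``every word over a finite alphabet'' may therefore be rendered by ranging
  over the finite subsets of one infinite type, such as \<^typ>\<open>nat\<close>.
\<close>

lemma factors_rename: "factors (h \<circ> x) n = map h ` factors x n"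
  by (simp add: factors_def image_image)

lemma inj_on_map_factors:
  assumes "inj_on h (range x)"
  shows "inj_on (map h) (factors x n)"
proof (rule inj_onI)
  fix v w assume "v \<in> factors x n" "w \<in> factors x n" and eq: "map h v = map h w"
  then have "set v \<union> set w \<subseteq> range x"
    by (auto simp: factors_def)
  then show "v = w"
    using eq assms by (meson inj_on_map_eq_map inj_on_subset)
qed

lemma ultimately_periodic_rename:
  assumes "inj_on h (range x)"
  shows "ultimately_periodic (h \<circ> x) \<longleftrightarrow> ultimately_periodic x"
  using assms by (simp add: ultimately_periodic_def inj_on_eq_iff)

lemma factor_complexity_rename:
  assumes "inj_on h (range x)"
  shows "factor_complexity (h \<circ> x) n = factor_complexity x n"
  unfolding factor_complexity_def factors_rename
  by (rule card_image[OF inj_on_map_factors[OF assms]])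

lemma palindrome_complexity_rename:
  assumes "inj_on h (range x)"
  shows "palindrome_complexity (h \<circ> x) n = palindrome_complexity x n"
proof -
  have "palindrome (map h w) \<longleftrightarrow> palindrome w" if "w \<in> factors x n" for w
  proof -
    have "set w \<subseteq> range x"
      using that by (auto simp: factors_def)
    then have "inj_on h (set (rev w) \<union> set w)"
      using assms by (simp add: inj_on_subset)
    then show ?thesis
      by (simp only: palindrome_def rev_map inj_on_map_eq_map)
  qed
  then have "{w \<in> factors (h \<circ> x) n. palindrome w} = map h ` {w \<in> factors x n. palindrome w}"
    unfolding factors_rename by auto
  moreover have "inj_on (map h) {w \<in> factors x n. palindrome w}"
    using inj_on_map_factors[OF assms] by (rule inj_on_subset) auto
  ultimately show ?thesis
    by (simp add: palindrome_complexity_def card_image)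
qed

end

theory Submission
  imports Defs "HOL-Real_Asymp.Real_Asymp"
begin

text \<open>
  Write \<open>p n\<close> for the palindrome complexity and \<open>\<rho> n\<close> for the factor complexity of a word.

  The growth condition implies convergence to \<open>0\<close> as soon as
  \<open>p n * ln (p n + 1) / \<rho> n \<longlonglongrightarrow> 0\<close> (\<open>palindromes_log_tendsto_0\<close>). The combinatorial core is the
  inequality \<open>S * p n \<le> \<rho> n + S * (2 * S * \<rho> (4 * S))\<close> for \<open>4 * S \<le> n\<close> (\<open>palindromes_bound\<close>).
  Take one occurrence of each palindrome of length \<open>n\<close> and slide the window by \<open>0, \<dots>, S - 1\<close>. If two
  of the resulting windows agree for different shifts, the common window starts with two
  palindromes with different centres. The composition of the two reflections is a translation,
  so the palindrome has a central part with a period at most \<open>2 * S\<close>. Palindromes without such a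
  period therefore contribute \<open>S\<close> factors each. Palindromes with such a period are determined by
  the period and by their first \<open>4 * S\<close> letters, so there are few of them.

  If the word has zero entropy, \<open>\<rho> (4 * S)\<close> is subexponential in \<open>S\<close>. For \<open>S\<close> equal to a large
  constant times \<open>ln (p n + 1)\<close>, the periodic palindromes are then fewer than half of all, and what
  remains is \<open>p n \<le> 2 * \<rho> n / S\<close>. If the entropy \<open>h\<close> is positive, a palindrome is determined by one
  of its halves, so that \<open>p n\<close> is roughly at most \<open>exp (h * n / 2)\<close> while \<open>\<rho> n \<ge> exp (h * n)\<close>.

  For the converse and for sharpness, a binary word is built scale by scale. At a scale with gap
  \<open>g\<close>, let \<open>J = g * (h + 1)\<close> and let \<open>y\<close> run through the \<open>2 ^ h\<close> words of length \<open>J\<close> that start with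
  \<open>1\<close> and have their other ones at multiples of \<open>g\<close>. The scale consists of the mirror-symmetric
  blocks \<open>0\<^sup>i (rev y) 0\<^sup>m y 0\<^sup>i\<close> of length \<open>6 * J\<close> with \<open>i < J\<close>, separated by blocks of zeros. These are
  \<open>J * 2 ^ h\<close> palindromes. A window that shows at most one of \<open>y\<close> and \<open>rev y\<close> does not see \<open>i\<close>, and a
  window that shows both has fewer than \<open>4 * J\<close> possible positions, so there are only about
  \<open>J\<^sup>2 * 2 ^ h\<close> factors. As \<open>J\<close> is proportional to \<open>h\<close>, this is \<open>t * ln t\<close> up to a factor depending on
  \<open>g\<close>, for \<open>t = J * 2 ^ h\<close>, and \<open>h\<close> is chosen such that \<open>f t\<close> beats this factor. The next scale has a
  gap as large as the window length \<open>6 * J\<close>. Hence the later scales show at most a single \<open>1\<close> in each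
  window and add only a linear number of factors.
\<close>

section \<open>Windows and palindromes\<close>

definition window :: "(nat \<Rightarrow> 'a) \<Rightarrow> nat \<Rightarrow> nat \<Rightarrow> 'a list" where
  "window x i n = map x [i..<i + n]"

lemma length_window [simp]: "length (window x i n) = n"
  by (simp add: window_def)

lemma nth_window [simp]: "k < n \<Longrightarrow> window x i n ! k = x (i + k)"
  by (simp add: window_def)

lemma factors_eq_windows: "factors x n = range (\<lambda>i. window x i n)"
  by (simp add: factors_def window_def)

lemma window_in_factors [simp, intro]: "window x i n \<in> factors x n"
  by (simp add: factors_eq_windows)

lemma length_factors: "w \<in> factors x n \<Longrightarrow> length w = n"
  by (auto simp: factors_eq_windows)

lemma window_eq_iff: "window x i n = window x j n \<longleftrightarrow> (\<forall>k<n. x (i + k) = x (j + k))"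
  by (auto simp: list_eq_iff_nth_eq)

lemma take_window: "m \<le> n \<Longrightarrow> take m (window x i n) = window x i m"
  by (auto simp: list_eq_iff_nth_eq)

lemma drop_window: "drop m (window x i n) = window x (i + m) (n - m)"
  by (auto simp: list_eq_iff_nth_eq add.assoc)

lemma palindromeD:
  "palindrome w \<Longrightarrow> k < length w \<Longrightarrow> w ! (length w - 1 - k) = w ! k"
  unfolding palindrome_def by (metis diff_Suc_eq_diff_pred rev_nth)

text \<open>
  A palindrome is determined by either of its halves, hence also by any longer suffix.
\<close>

lemma palindromes_eqI:
  assumes "w \<in> factors x n" "v \<in> factors x n" "palindrome w" "palindrome v"
    and "\<And>k. k < n \<Longrightarrow> s \<le> k \<Longrightarrow> w ! k = v ! k" and "2 * s \<le> n"
  shows "w = v"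
proof (rule nth_equalityI)
  have lw: "length w = n" and lv: "length v = n" using assms length_factors by auto
  then show "length w = length v" by simp
  fix k assume "k < length w"
  then have k: "k < n" using lw by simp
  show "w ! k = v ! k"
  proof (cases "s \<le> k")
    case True then show ?thesis using assms k by simp
  next
    case False
    then have "w ! (n - 1 - k) = v ! (n - 1 - k)" using assms(5,6) k by simp
    then show ?thesis using palindromeD[OF assms(3), of k] palindromeD[OF assms(4), of k] lw lv k by simp
  qed
qed

section \<open>Factor complexity\<close>

locale finite_word =
  fixes A :: "'a set" and x :: "nat \<Rightarrow> 'a"
  assumes fin: "finite A" and rng: "range x \<subseteq> A"
begin

abbreviation "\<rho> \<equiv> factor_complexity x"
abbreviation "p \<equiv> palindrome_complexity x"

lemma finite_factors_x [simp, intro]: "finite (factors x n)"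
  using finite_factors[OF fin rng] .

lemma complexity_pos: "\<rho> n \<ge> 1"
  unfolding factor_complexity_def
  using card_gt_0_iff[of "factors x n"] window_in_factors[of x 0 n] by fastforce

lemma complexity_mono: assumes "m \<le> n" shows "\<rho> m \<le> \<rho> n"
proof -
  have "factors x m = take m ` factors x n"
    using assms by (simp add: factors_eq_windows image_image take_window)
  then show ?thesis
    unfolding factor_complexity_def by (simp add: card_image_le)
qed

lemma complexity_submult: "\<rho> (m + n) \<le> \<rho> m * \<rho> n"
proof -
  have "inj_on (\<lambda>w. (take m w, drop m w)) (factors x (m + n))"
    by (rule inj_onI) (metis append_take_drop_id prod.inject)
  moreover have "(\<lambda>w. (take m w, drop m w)) ` factors x (m + n) \<subseteq> factors x m \<times> factors x n"
    by (auto simp: factors_eq_windows take_window drop_window)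
  ultimately have "card (factors x (m + n)) \<le> card (factors x m \<times> factors x n)"
    by (intro card_inj_on_le) auto
  then show ?thesis by (simp add: factor_complexity_def card_cartesian_product)
qed

lemma palindromes_le: "p n \<le> \<rho> n"
  unfolding factor_complexity_def palindrome_complexity_def by (intro card_mono) auto

lemma palindromes_le_half: "p n \<le> \<rho> (n - n div 2)"
proof -
  let ?P = "{w \<in> factors x n. palindrome w}"
  have "inj_on (drop (n div 2)) ?P"
  proof (rule inj_onI)
    fix w v assume wv: "w \<in> ?P" "v \<in> ?P" "drop (n div 2) w = drop (n div 2) v"
    show "w = v"
    proof (rule palindromes_eqI[where s = "n div 2"])
      fix k assume "k < n" "n div 2 \<le> k"
      moreover have "length w = n" "length v = n" using wv length_factors by auto
      ultimately have "w ! k = drop (n div 2) w ! (k - n div 2)" "v ! k = drop (n div 2) v ! (k - n div 2)"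
        by simp_all
      then show "w ! k = v ! k" using wv(3) by simp
    qed (use wv in auto)
  qed
  moreover have "drop (n div 2) ` ?P \<subseteq> factors x (n - n div 2)"
    by (auto simp: factors_eq_windows drop_window)
  ultimately show ?thesis
    unfolding factor_complexity_def palindrome_complexity_def by (intro card_inj_on_le) auto
qed

text \<open>
  The strict growth of Morse and Hedlund: if the number of factors does not increase, each factor of
  length \<open>n\<close> has a unique next letter, and from the first repeated factor on the word repeats itself.
\<close>

lemma complexity_less_Suc:
  assumes "\<not> ultimately_periodic x"
  shows "\<rho> n < \<rho> (Suc n)"
proof (rule ccontr)
  assume "\<not> \<rho> n < \<rho> (Suc n)"
  then have le: "card (factors x (Suc n)) \<le> card (factors x n)"
    by (simp add: factor_complexity_def)
  have img: "take n ` factors x (Suc n) = factors x n"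
    by (simp add: factors_eq_windows image_image take_window)
  have inj: "inj_on (take n) (factors x (Suc n))"
    by (rule eq_card_imp_inj_on) (use le img card_image_le[of "factors x (Suc n)" "take n"] in auto)
  have next_letter: "x (i + n) = x (j + n)" if "window x i n = window x j n" for i j
  proof -
    have "window x i (Suc n) = window x j (Suc n)"
      using inj that by (metis Suc_n_not_le_n inj_onD nle_le take_window window_in_factors)
    then show ?thesis by (simp add: window_eq_iff)
  qed
  have "\<not> inj_on (\<lambda>i. window x i n) UNIV"
    using finite_factors_x[of n] unfolding factors_eq_windows
    using finite_imageD infinite_UNIV_nat by blast
  then obtain i j where ij: "i < j" "window x i n = window x j n"
    unfolding inj_on_def by (metis linorder_neqE_nat)
  have win: "window x (i + k) n = window x (j + k) n" for k
  proof (induction k)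
    case 0 then show ?case using ij by simp
  next
    case (Suc k)
    have "x (i + Suc k + l) = x (j + Suc k + l)" if "l < n" for l
    proof (cases "Suc l < n")
      case True
      then show ?thesis using Suc[unfolded window_eq_iff] by (metis add_Suc_right add_Suc)
    next
      case False
      then have "i + Suc k + l = i + k + n" "j + Suc k + l = j + k + n" using that by auto
      then show ?thesis using next_letter[OF Suc] by metis
    qed
    then show ?case by (simp add: window_eq_iff)
  qed
  have "x (k + (j - i)) = x k" if "k \<ge> i + n" for k
  proof -
    have "x (i + (k - i - n) + n) = x (j + (k - i - n) + n)"
      using next_letter[OF win] .
    moreover have "i + (k - i - n) + n = k" "j + (k - i - n) + n = k + (j - i)" using that ij by auto
    ultimately show ?thesis by metis
  qed
  then have "ultimately_periodic x"
    unfolding ultimately_periodic_def using ij by (intro exI[of _ "j - i"]) auto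
  with assms show False by simp
qed

lemma complexity_gt:
  assumes "\<not> ultimately_periodic x"
  shows "\<rho> n > n"
proof (induction n)
  case 0 then show ?case using complexity_pos[of 0] by simp
next
  case (Suc n) then show ?case using complexity_less_Suc[OF assms, of n] by simp
qed

text \<open>
  By submultiplicativity, an exponential bound at a single length \<open>m\<close> spreads to all lengths: cover
  \<open>n\<close> letters by \<open>n div m + 1\<close> blocks of length \<open>m\<close>.
\<close>

lemma complexity_exp_upper:
  assumes "m \<ge> 1" "c \<ge> 0" "real (\<rho> m) \<le> exp (c * real m)"
  shows "\<exists>C>0. \<forall>n. real (\<rho> n) \<le> C * exp (c * real n)"
proof (intro exI conjI allI)
  have mult: "\<rho> (k * m) \<le> \<rho> m ^ k" if "k \<ge> 1" for k
    using that
  proof (induction k rule: dec_induct)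
    case (step k)
    have "\<rho> (m + k * m) \<le> \<rho> m * \<rho> (k * m)" by (rule complexity_submult)
    also have "\<dots> \<le> \<rho> m * \<rho> m ^ k" using step by simp
    finally show ?case by simp
  qed simp
  fix n
  let ?k = "Suc (n div m)"
  have "n \<le> ?k * m"
    using assms(1) dividend_less_div_times[of m n] by simp
  then have "\<rho> n \<le> \<rho> (?k * m)" by (rule complexity_mono)
  also have "\<dots> \<le> \<rho> m ^ ?k" by (rule mult) simp
  finally have "real (\<rho> n) \<le> real (\<rho> m) ^ ?k"
    by (metis of_nat_le_iff of_nat_power)
  also have "\<dots> \<le> exp (c * real m) ^ ?k"
    using assms by (intro power_mono) auto
  also have "\<dots> = exp (c * real m) * exp (c * (real m * real (n div m)))"
    by (simp add: exp_of_nat_mult[symmetric] mult.commute)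
  also have "\<dots> \<le> exp (c * real m) * exp (c * real n)"
  proof -
    have "real m * real (n div m) \<le> real n"
      by (metis of_nat_le_iff of_nat_mult times_div_less_eq_dividend)
    then show ?thesis using assms by (simp add: mult_left_mono)
  qed
  finally show "real (\<rho> n) \<le> exp (c * real m) * exp (c * real n)" .
qed simp

text \<open>
  Fekete's argument: \<open>h\<close> is the infimum of \<open>ln (\<rho> m) / m\<close>. A length that nearly attains the infimum
  gives the upper bounds through the preceding lemma.
\<close>

lemma entropy:
  obtains h where "h \<ge> 0" "\<And>n. real (\<rho> n) \<ge> exp (h * real n)"
    "\<And>c. c > h \<Longrightarrow> \<exists>C>0. \<forall>n. real (\<rho> n) \<le> C * exp (c * real n)"
proof -
  let ?E = "(\<lambda>m. ln (real (\<rho> m)) / real m) ` {1..}"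
  define h where "h = Inf ?E"
  have nn: "e \<ge> 0" if "e \<in> ?E" for e
    using that complexity_pos by auto
  then have bdd: "bdd_below ?E" by (intro bdd_belowI)
  have "h \<ge> 0" unfolding h_def by (rule cInf_greatest) (use nn in auto)
  moreover have "real (\<rho> n) \<ge> exp (h * real n)" for n
  proof (cases "n = 0")
    case True then show ?thesis using complexity_pos[of 0] by simp
  next
    case False
    then have "h \<le> ln (real (\<rho> n)) / real n"
      unfolding h_def using bdd by (intro cInf_lower) auto
    then have "h * real n \<le> ln (real (\<rho> n))"
      using False by (simp add: field_simps)
    then show ?thesis using complexity_pos[of n] by (simp add: ln_ge_iff)
  qed
  moreover have "\<exists>C>0. \<forall>n. real (\<rho> n) \<le> C * exp (c * real n)" if "c > h" for c
  proof -
    have "\<exists>e\<in>?E. e < c"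
      using that unfolding h_def by (intro cInf_lessD) auto
    then obtain m where m: "m \<ge> 1" "ln (real (\<rho> m)) / real m < c" by auto
    then have "ln (real (\<rho> m)) \<le> c * real m" by (simp add: field_simps)
    then have "real (\<rho> m) \<le> exp (c * real m)"
      using complexity_pos[of m] by (metis exp_ln exp_le_cancel_iff not_one_le_zero of_nat_0_less_iff not_gr_zero)
    then show ?thesis using m that \<open>h \<ge> 0\<close> by (intro complexity_exp_upper) auto
  qed
  ultimately show ?thesis using that by blast
qed

section \<open>Counting palindromes\<close>

text \<open>
  The core is what remains of \<open>w\<close> after cutting off \<open>d\<close> letters on both sides.
\<close>

definition core_period :: "nat \<Rightarrow> nat \<Rightarrow> 'b list \<Rightarrow> bool" where
  "core_period d q w \<longleftrightarrow> (\<forall>k. d \<le> k \<and> k + q < length w - d \<longrightarrow> w ! (k + q) = w ! k)"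

text \<open>
  The first \<open>4 * S\<close> letters contain a full period of the core. They fix the core, and the last
  \<open>2 * S\<close> letters mirror the first ones.
\<close>

lemma card_periodic_core_palindromes:
  assumes "4 * S \<le> n"
  shows "card {w \<in> factors x n. palindrome w \<and> (\<exists>q\<in>{1..2 * S}. core_period (2 * S) q w)}
           \<le> 2 * S * \<rho> (4 * S)"
proof -
  let ?B = "{w \<in> factors x n. palindrome w \<and> (\<exists>q\<in>{1..2 * S}. core_period (2 * S) q w)}"
  define per where "per w = (SOME q. q \<in> {1..2 * S} \<and> core_period (2 * S) q w)" for w :: "'a list"
  have per: "per w \<in> {1..2 * S} \<and> core_period (2 * S) (per w) w" if "w \<in> ?B" for w
    unfolding per_def by (rule someI_ex) (use that in blast)
  have "inj_on (\<lambda>w. (per w, take (4 * S) w)) ?B"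
  proof (rule inj_onI)
    fix w v assume w: "w \<in> ?B" and v: "v \<in> ?B"
      and eq: "(per w, take (4 * S) w) = (per v, take (4 * S) v)"
    define q where "q = per w"
    have q: "1 \<le> q" "q \<le> 2 * S" "core_period (2 * S) q w" "core_period (2 * S) q v"
      using per[OF w] per[OF v] eq by (auto simp: q_def)
    have len: "length w = n" "length v = n" using w v length_factors by auto
    have left: "w ! k = v ! k" if "k < n - 2 * S" for k
      using that
    proof (induction k rule: less_induct)
      case (less k)
      show ?case
      proof (cases "k < 4 * S")
        case True
        then show ?thesis using eq by (metis nth_take prod.inject)
      next
        case False
        have "u ! k = u ! (k - q)" if "core_period (2 * S) q u" "length u = n" for u :: "'a list"
        proof -
          have "u ! ((k - q) + q) = u ! (k - q)"
            using that False q(1,2) less.prems by (intro that(1)[unfolded core_period_def, rule_format]) simp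
          then show ?thesis using False q(2) by simp
        qed
        moreover have "w ! (k - q) = v ! (k - q)" using less False q by auto
        ultimately show ?thesis using q len by simp
      qed
    qed
    show "w = v"
    proof (rule nth_equalityI)
      fix k assume "k < length w"
      then have k: "k < n" using len by simp
      show "w ! k = v ! k"
      proof (cases "k < n - 2 * S")
        case False
        then have "w ! (n - 1 - k) = v ! (n - 1 - k)" using assms k by (intro left) auto
        then show ?thesis
          using palindromeD[of w k] palindromeD[of v k] w v len k by simp
      qed (use left in simp)
    qed (use len in simp)
  qed
  moreover have "(\<lambda>w. (per w, take (4 * S) w)) ` ?B \<subseteq> {1..2 * S} \<times> factors x (4 * S)"
  proof (clarify, intro conjI SigmaI)
    fix w q assume w: "w \<in> factors x n" "palindrome w" "q \<in> {1..2 * S}" "core_period (2 * S) q w"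
    then show "per w \<in> {1..2 * S}" using per[of w] by blast
    show "take (4 * S) w \<in> factors x (4 * S)"
      using w(1) assms by (auto simp: factors_eq_windows take_window)
  qed
  ultimately have "card ?B \<le> card ({1..2 * S} \<times> factors x (4 * S))"
    by (intro card_inj_on_le) auto
  then show ?thesis by (simp add: factor_complexity_def card_cartesian_product)
qed

text \<open>
  The windows at distance \<open>s < S\<close> to the right of a chosen occurrence are pairwise distinct. For
  equal shifts this is the determination of a palindrome by its half. For different shifts the
  common window has two palindromic prefixes of different lengths, and the longer one has the
  difference of the lengths as a period.
\<close>

lemma card_aperiodic_core_palindromes:
  assumes "4 * S \<le> n"
  shows "S * card {w \<in> factors x n. palindrome w \<and> \<not> (\<exists>q\<in>{1..2 * S}. core_period (2 * S) q w)}
           \<le> \<rho> n"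
proof -
  let ?G = "{w \<in> factors x n. palindrome w \<and> \<not> (\<exists>q\<in>{1..2 * S}. core_period (2 * S) q w)}"
  define pos where "pos w = (SOME i. w = window x i n)" for w
  have pos: "w = window x (pos w) n" if "w \<in> ?G" for w
    unfolding pos_def by (rule someI_ex) (use that in \<open>auto simp: factors_eq_windows\<close>)
  have no_shift: "\<not> s < s'"
    if w: "w \<in> ?G" and v: "v \<in> ?G" and s: "s < S" "s' < S"
      and eq: "window x (pos w + s) n = window x (pos v + s') n" for w v s s'
  proof
    assume less: "s < s'"
    have len: "length w = n" "length v = n" using w v length_factors by auto
    have nth: "u ! k = x (pos u + k)" if "u \<in> ?G" "k < n" for u k
      using pos[OF that(1)] nth_window[OF that(2), of x "pos u"] by simp
    have refl: "x (pos u + r + (n - 2 * r - 1 - k)) = x (pos u + r + k)"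
      if "u \<in> ?G" "k < n - 2 * r" for u r k
    proof -
      have "palindrome u" "length u = n" using that length_factors by auto
      then have "u ! (n - 1 - (r + k)) = u ! (r + k)" using palindromeD[of u "r + k"] that by simp
      moreover have "n - 1 - (r + k) = r + (n - 2 * r - 1 - k)" using that by simp
      ultimately show ?thesis
        using nth[OF that(1), of "r + k"] nth[OF that(1), of "r + (n - 2 * r - 1 - k)"] that
        by (simp add: add.assoc)
    qed
    (* the palindromic prefixes of the common window have lengths n - 2 s and n - 2 s' *)
    define d where "d = 2 * (s' - s)"
    have "core_period (2 * S) d w"
      unfolding core_period_def
    proof (intro allI impI, elim conjE)
      fix k assume k: "2 * S \<le> k" "k + d < length w - 2 * S"
      define l where "l = k - s"
      have l: "k = s + l" "l + d < n - 2 * s" "l < n - 2 * s'"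
        using k s less len by (auto simp: l_def d_def)
      have e: "x (pos w + s + i) = x (pos v + s' + i)" if "i < n" for i
        using eq that by (simp add: window_eq_iff)
      have "w ! (k + d) = x (pos w + s + (l + d))"
        using nth[OF w] l k len by (simp add: add.assoc)
      also have "\<dots> = x (pos w + s + (n - 2 * s - 1 - (l + d)))"
        using refl[OF w l(2)] by simp
      also have "n - 2 * s - 1 - (l + d) = n - 2 * s' - 1 - l"
        using l less by (simp add: d_def)
      also have "x (pos w + s + (n - 2 * s' - 1 - l)) = x (pos v + s' + (n - 2 * s' - 1 - l))"
        using l by (intro e) simp
      also have "\<dots> = x (pos v + s' + l)" using refl[OF v l(3)] .
      also have "\<dots> = x (pos w + s + l)" using e l by simp
      also have "\<dots> = w ! k" using nth[OF w] l k len by (simp add: add.assoc)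
      finally show "w ! (k + d) = w ! k" .
    qed
    moreover have "d \<in> {1..2 * S}" using less s by (auto simp: d_def)
    ultimately show False using w by blast
  qed
  have "inj_on (\<lambda>(s, w). window x (pos w + s) n) ({..<S} \<times> ?G)"
  proof (rule inj_onI)
    fix a b assume a: "a \<in> {..<S} \<times> ?G" and b: "b \<in> {..<S} \<times> ?G"
      and ab: "(\<lambda>(s, w). window x (pos w + s) n) a = (\<lambda>(s, w). window x (pos w + s) n) b"
    obtain s w s' v where a_eq: "a = (s, w)" and b_eq: "b = (s', v)" by fastforce
    have s: "s < S" "s' < S" and w: "w \<in> ?G" and v: "v \<in> ?G"
      using a b unfolding a_eq b_eq by blast+
    have eq: "window x (pos w + s) n = window x (pos v + s') n"
      using ab unfolding a_eq b_eq by simp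
    have ss: "s = s'"
      using no_shift[OF w v s eq] no_shift[OF v w s(2,1) eq[symmetric]] by simp
    have "w = v"
    proof (rule palindromes_eqI[where s = s])
      fix k assume k: "k < n" "s \<le> k"
      have "x (pos w + s + (k - s)) = x (pos v + s + (k - s))"
        using eq k ss unfolding window_eq_iff by (metis less_imp_diff_less)
      moreover have "pos w + s + (k - s) = pos w + k" "pos v + s + (k - s) = pos v + k" using k by auto
      ultimately have "x (pos w + k) = x (pos v + k)" by metis
      then show "w ! k = v ! k"
        using pos[OF w] pos[OF v] nth_window[OF k(1), of x "pos w"] nth_window[OF k(1), of x "pos v"] by simp
    qed (use w v s assms in auto)
    with ss show "a = b" by (simp add: a_eq b_eq)
  qed
  then have "card ({..<S} \<times> ?G) \<le> card (factors x n)"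
    by (rule card_inj_on_le) auto
  then show ?thesis by (simp add: factor_complexity_def card_cartesian_product)
qed

lemma palindromes_bound:
  assumes "4 * S \<le> n"
  shows "S * p n \<le> \<rho> n + S * (2 * S * \<rho> (4 * S))"
proof -
  let ?Q = "\<lambda>w. \<exists>q\<in>{1..2 * S}. core_period (2 * S) q w"
  have "{w \<in> factors x n. palindrome w} =
    {w \<in> factors x n. palindrome w \<and> \<not> ?Q w} \<union> {w \<in> factors x n. palindrome w \<and> ?Q w}"
    by blast
  then have "p n \<le> card {w \<in> factors x n. palindrome w \<and> \<not> ?Q w}
                 + card {w \<in> factors x n. palindrome w \<and> ?Q w}"
    unfolding palindrome_complexity_def by (metis (lifting) card_Un_le)
  from mult_le_mono2[OF this, of S]
  have "S * p n \<le> S * card {w \<in> factors x n. palindrome w \<and> \<not> ?Q w}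
                 + S * card {w \<in> factors x n. palindrome w \<and> ?Q w}"
    by (simp only: distrib_left)
  also have "\<dots> \<le> \<rho> n + S * (2 * S * \<rho> (4 * S))"
    by (intro add_mono mult_le_mono2 card_aperiodic_core_palindromes card_periodic_core_palindromes assms)
  finally show ?thesis .
qed

text \<open>
  The shift range \<open>S\<close> of the preceding inequality is about \<open>K * ln (p n + 1)\<close>. In the case of zero
  entropy, \<open>2 * S * \<rho> (4 * S)\<close> is then, for each fixed \<open>K\<close>, at most about the square root
  of \<open>p n\<close>, up to a logarithmic factor.
\<close>

lemma palindromes_log_tendsto_0:
  assumes "\<not> ultimately_periodic x"
  shows "(\<lambda>n. real (p n) * ln (real (p n) + 1) / real (\<rho> n)) \<longlonglongrightarrow> 0"
proof -
  have ln_le: "ln (real m + 1) \<le> ln (C + 1) + b" if "real m \<le> C * exp b" "C > 0" "b \<ge> 0" for m C b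
  proof -
    have "real m + 1 \<le> (C + 1) * exp b" using that by (simp add: distrib_right add_mono)
    then have "ln (real m + 1) \<le> ln ((C + 1) * exp b)" by (simp add: add_pos_nonneg)
    then show ?thesis using that by (simp add: ln_mult)
  qed
  have half: "real (n - n div 2) \<le> (real n + 1) / 2" for n :: nat
    by (cases "even n") (auto elim!: evenE oddE)
  obtain h where h: "h \<ge> 0" "\<And>n. real (\<rho> n) \<ge> exp (h * real n)"
    "\<And>c. c > h \<Longrightarrow> \<exists>C>0. \<forall>n. real (\<rho> n) \<le> C * exp (c * real n)"
    using entropy by blast
  show ?thesis
  proof (cases "h > 0")
    case True
    (* the factor 3 / 2 may be any number between 1 and 2: halves of palindromes give exp (3 / 4 h n) *)
    then have "3 / 2 * h > h" by simp
    then obtain C where C: "C > 0" "\<And>n. real (\<rho> n) \<le> C * exp (3 / 2 * h * real n)"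
      using h(3) by blast
    define b where "b n = 3 / 4 * h * (real n + 1)" for n
    have b: "b n \<ge> 0" for n using True by (simp add: b_def)
    have p: "real (p n) \<le> C * exp (b n)" for n
    proof -
      have "real (p n) \<le> real (\<rho> (n - n div 2))" using palindromes_le_half[of n] by simp
      also have "\<dots> \<le> C * exp (3 / 2 * h * real (n - n div 2))" by (rule C)
      also have "3 / 2 * h * real (n - n div 2) \<le> 3 / 2 * h * ((real n + 1) / 2)"
        using True half by (intro mult_left_mono) auto
      then have "C * exp (3 / 2 * h * real (n - n div 2)) \<le> C * exp (b n)"
        using C(1) by (simp add: b_def)
      finally show ?thesis .
    qed
    have le: "norm (real (p n) * ln (real (p n) + 1) / real (\<rho> n))
          \<le> C * exp (b n) * (ln (C + 1) + b n) / exp (h * real n)" for n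
    proof -
      have "norm (real (p n) * ln (real (p n) + 1) / real (\<rho> n))
            = real (p n) * ln (real (p n) + 1) / real (\<rho> n)"
        by simp
      also have "\<dots> \<le> C * exp (b n) * (ln (C + 1) + b n) / exp (h * real n)"
        using p[of n] ln_le[OF p C(1) b, of n] h(2)[of n] C(1) b[of n] ln_ge_zero[of "C + 1"]
        by (intro frac_le mult_mono) auto
      finally show ?thesis .
    qed
    have lim: "(\<lambda>n. C * exp (b n) * (ln (C + 1) + b n) / exp (h * real n)) \<longlonglongrightarrow> 0"
      unfolding b_def using True C(1) by real_asymp
    show ?thesis
      by (rule Lim_null_comparison[OF always_eventually[OF allI[OF le]] lim])
  next
    case False
    then have h0: "h = 0" using h(1) by simp
    show ?thesis
    proof (rule LIMSEQ_I, goal_cases)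
      case (1 \<epsilon>)
      (* K yields the bound 2 / K < \<epsilon>; c makes exp (4 c K ln (p n + 1)) equal to sqrt (p n + 1) *)
      define K where "K = 4 / \<epsilon>"
      define c where "c = 1 / (8 * K)"
      have K: "K > 0" "c > 0" using 1 by (simp_all add: K_def c_def)
      obtain C where C: "C > 0" "\<And>n. real (\<rho> n) \<le> C * exp (c * real n)"
        using h(3)[of c] h0 K by blast
      have "eventually (\<lambda>t::real. 2 * (K * ln (t + 1) + 1) * C * exp (4 * c) * exp (ln (t + 1) / 2) \<le> t / 2) at_top"
        using K C(1) by real_asymp
      then obtain P0 where P0: "\<And>t. t \<ge> P0 \<Longrightarrow>
          2 * (K * ln (t + 1) + 1) * C * exp (4 * c) * exp (ln (t + 1) / 2) \<le> t / 2"
        unfolding eventually_at_top_linorder by blast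
      define P where "P = max P0 1"
      have "eventually (\<lambda>n. 4 * (K * ln (C + 1) + 1) + real n / 2 \<le> real n \<and> P * ln (P + 1) / real n < \<epsilon>) at_top"
        using 1 by (intro eventually_conj; real_asymp)
      then obtain N where N: "\<And>n. n \<ge> N \<Longrightarrow>
          4 * (K * ln (C + 1) + 1) + real n / 2 \<le> real n \<and> P * ln (P + 1) / real n < \<epsilon>"
        unfolding eventually_at_top_linorder by blast
      have "real (p n) * ln (real (p n) + 1) / real (\<rho> n) < \<epsilon>" if n: "n \<ge> max N 1" for n
      (* for few palindromes, the bound \<rho> n > n suffices *)
      proof (cases "real (p n) \<ge> P")
        case True
        define L where "L = ln (real (p n) + 1)"
        have L: "L \<ge> 0" by (simp add: L_def)
        define S where "S = nat \<lceil>K * L\<rceil>"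
        have S: "real S \<ge> K * L" "real S \<le> K * L + 1"
          using K L by (auto simp: S_def)
        have "L > 0" using True by (auto simp: L_def P_def)
        then have S0: "real S > 0" using S K by (meson less_le_trans mult_pos_pos)
        have "L \<le> ln (C + 1) + c * real n"
          unfolding L_def using C K palindromes_le[of n] by (intro ln_le) (auto intro: order_trans of_nat_mono)
        then have "K * L \<le> K * (ln (C + 1) + c * real n)" using K by simp
        also have "\<dots> = K * ln (C + 1) + real n / 8" using K by (simp add: c_def field_simps)
        finally have KL: "K * L \<le> K * ln (C + 1) + real n / 8" .
        have "4 * real S \<le> 4 * (K * L + 1)" using S(2) by simp
        also have "\<dots> \<le> 4 * (K * ln (C + 1) + real n / 8 + 1)" using KL by simp
        also have "\<dots> = 4 * (K * ln (C + 1) + 1) + real n / 2" by (simp add: field_simps)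
        also have "\<dots> \<le> real n" using N[of n] n by simp
        finally have "4 * real S \<le> real n" .
        then have "4 * S \<le> n" by linarith
        from palindromes_bound[OF this]
        have bound: "real S * real (p n) \<le> real (\<rho> n) + real S * (2 * real S * real (\<rho> (4 * S)))"
          by (metis (mono_tags) of_nat_add of_nat_le_iff of_nat_mult of_nat_numeral)
        have "2 * real S * real (\<rho> (4 * S)) \<le> 2 * (K * L + 1) * (C * exp (c * real (4 * S)))"
          using S K L C(1) C(2)[of "4 * S"] by (intro mult_mono) auto
        also have "c * real (4 * S) \<le> c * (4 * (K * L + 1))" using S K by (intro mult_left_mono) auto
        also have "c * (4 * (K * L + 1)) = 4 * c + L / 2" using K by (simp add: c_def field_simps)
        finally have "2 * real S * real (\<rho> (4 * S)) \<le> 2 * (K * L + 1) * (C * exp (4 * c + L / 2))"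
          using K L C by (simp add: mult_left_mono)
        also have "\<dots> \<le> real (p n) / 2"
          using P0[of "real (p n)"] True by (simp add: P_def L_def exp_add mult.assoc)
        finally have "real S * (2 * real S * real (\<rho> (4 * S))) \<le> real S * (real (p n) / 2)"
          using S0 by (intro mult_left_mono) auto
        with bound have "real S * real (p n) \<le> 2 * real (\<rho> n)" by simp
        moreover have "K * L * real (p n) \<le> real S * real (p n)" using S by (intro mult_right_mono) auto
        ultimately have "K * (real (p n) * L) \<le> 2 * real (\<rho> n)" by (simp add: mult_ac)
        then have "real (p n) * L / real (\<rho> n) \<le> 2 / K"
          using K complexity_pos[of n] by (simp add: field_simps)
        also have "\<dots> < \<epsilon>" using 1 by (simp add: K_def)
        finally show ?thesis by (simp add: L_def)
      next
        case False
        then have "real (p n) * ln (real (p n) + 1) \<le> P * ln (P + 1)"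
          by (intro mult_mono) (auto simp: P_def)
        then have "real (p n) * ln (real (p n) + 1) / real (\<rho> n) \<le> P * ln (P + 1) / real n"
          using complexity_gt[OF assms, of n] n by (intro frac_le) (auto simp: P_def)
        then show ?thesis using N[of n] n by simp
      qed
      then show ?case by (intro exI[of _ "max N 1"]) auto
    qed
  qed
qed

end

section \<open>Binary words as sets of positions\<close>

definition char_word :: "nat set \<Rightarrow> nat \<Rightarrow> nat" where
  "char_word X k = (if k \<in> X then 1 else 0)"

text \<open>
  A factor of a binary word is encoded by the set of its ones. A word with few ones is then described
  by where these ones are, without a case distinction over zero blocks.
\<close>

definition trace :: "nat set \<Rightarrow> nat \<Rightarrow> nat \<Rightarrow> nat set" where
  "trace X s n = {k. k < n \<and> s + k \<in> X}"

definition mirror_symmetric :: "nat \<Rightarrow> nat set \<Rightarrow> bool" where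
  "mirror_symmetric n K \<longleftrightarrow> (\<forall>k<n. n - 1 - k \<in> K \<longleftrightarrow> k \<in> K)"

lemma finite_range_trace [simp]: "finite ((\<lambda>s. trace X s n) ` S)"
  by (rule finite_subset[of _ "Pow {..<n}"]) (auto simp: trace_def)

lemma trace_bij_factors:
  defines "ones \<equiv> \<lambda>w. {k. k < length w \<and> w ! k = (1::nat)}"
  shows "bij_betw ones (factors (char_word X) n) (range (\<lambda>s. trace X s n))"
    and "w \<in> factors (char_word X) n \<Longrightarrow> mirror_symmetric n (ones w) \<longleftrightarrow> palindrome w"
proof -
  have nth: "length w = n \<and> (\<forall>k<n. w ! k \<in> {0, 1})" if "w \<in> factors (char_word X) n" for w
    using that by (auto simp: factors_def char_word_def)
  have ones: "ones (map (char_word X) [s..<s + n]) = trace X s n" for s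
    by (auto simp: ones_def trace_def char_word_def split: if_splits)
  have "inj_on ones (factors (char_word X) n)"
  proof (rule inj_onI)
    fix v w assume v: "v \<in> factors (char_word X) n" and w: "w \<in> factors (char_word X) n"
      and eq: "ones v = ones w"
    show "v = w"
    proof (rule nth_equalityI)
      fix k assume "k < length v"
      then have k: "k < n" using nth[OF v] by simp
      have "k \<in> ones v \<longleftrightarrow> k \<in> ones w" using eq by simp
      then have "v ! k = 1 \<longleftrightarrow> w ! k = 1" using k nth[OF v] nth[OF w] by (simp add: ones_def)
      moreover have "v ! k \<in> {0, 1}" "w ! k \<in> {0, 1}" using k nth[OF v] nth[OF w] by blast+
      ultimately show "v ! k = w ! k" by auto
    qed (use nth[OF v] nth[OF w] in simp)
  qed
  moreover have "ones ` factors (char_word X) n = range (\<lambda>s. trace X s n)"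
    by (simp add: factors_def image_image ones)
  ultimately show "bij_betw ones (factors (char_word X) n) (range (\<lambda>s. trace X s n))"
    by (simp add: bij_betw_def)
  show "mirror_symmetric n (ones w) \<longleftrightarrow> palindrome w" if w: "w \<in> factors (char_word X) n"
  proof -
    note len = nth[OF w]
    have "palindrome w \<longleftrightarrow> (\<forall>k<n. w ! (n - 1 - k) = w ! k)"
      using len by (auto simp: palindrome_def list_eq_iff_nth_eq rev_nth)
    also have "\<dots> \<longleftrightarrow> (\<forall>k<n. w ! (n - 1 - k) = 1 \<longleftrightarrow> w ! k = 1)"
    proof (intro all_cong)
      fix k assume "k < n"
      then have "w ! k \<in> {0, 1}" "w ! (n - 1 - k) \<in> {0, 1}" using len by auto
      then show "(w ! (n - 1 - k) = w ! k) = (w ! (n - 1 - k) = 1 \<longleftrightarrow> w ! k = 1)" by auto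
    qed
    also have "\<dots> \<longleftrightarrow> mirror_symmetric n (ones w)"
      using len by (auto simp: mirror_symmetric_def ones_def)
    finally show ?thesis by simp
  qed
qed

lemma factor_complexity_char_word:
  "factor_complexity (char_word X) n = card (range (\<lambda>s. trace X s n))"
  unfolding factor_complexity_def using bij_betw_same_card[OF trace_bij_factors(1)] .

lemma palindrome_complexity_char_word:
  "palindrome_complexity (char_word X) n = card {K \<in> range (\<lambda>s. trace X s n). mirror_symmetric n K}"
proof -
  let ?ones = "\<lambda>w. {k. k < length w \<and> w ! k = (1::nat)}"
  have inj: "inj_on ?ones (factors (char_word X) n)"
    and img: "?ones ` factors (char_word X) n = range (\<lambda>s. trace X s n)"
    using trace_bij_factors(1)[of X n] by (simp_all add: bij_betw_def)
  have "{K \<in> range (\<lambda>s. trace X s n). mirror_symmetric n K}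
      = ?ones ` {w \<in> factors (char_word X) n. palindrome w}"
    unfolding img[symmetric] using trace_bij_factors(2)[of _ X n] by blast
  moreover have "inj_on ?ones {w \<in> factors (char_word X) n. palindrome w}"
    using inj by (rule inj_on_subset) auto
  ultimately show ?thesis
    unfolding palindrome_complexity_def by (simp add: card_image)
qed

definition sparse :: "nat \<Rightarrow> nat set \<Rightarrow> bool" where
  "sparse g X \<longleftrightarrow> (\<forall>a\<in>X. \<forall>b\<in>X. a < b \<longrightarrow> a + g \<le> b)"

lemma sparseD: "sparse g X \<Longrightarrow> a \<in> X \<Longrightarrow> b \<in> X \<Longrightarrow> a < b \<Longrightarrow> a + g \<le> b"
  by (auto simp: sparse_def)

text \<open>
  From \<open>P\<close> on, each window contains at most one \<open>1\<close>. This bounds what all later scales contribute.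
\<close>

lemma card_sparse_traces:
  assumes "sparse n (X \<inter> {P..})"
  shows "card ((\<lambda>s. trace X s n) ` {P..}) \<le> n + 1"
proof -
  have "(\<lambda>s. trace X s n) ` {P..} \<subseteq> insert {} ((\<lambda>k. {k}) ` {..<n})"
  proof clarify
    fix s assume s: "s \<ge> P" and "trace X s n \<notin> (\<lambda>k. {k}) ` {..<n}"
    have "a = b" if "a \<in> trace X s n" "b \<in> trace X s n" for a b
    proof (rule ccontr)
      assume "a \<noteq> b"
      then consider "s + a < s + b" | "s + b < s + a" by linarith
      then show False
        using that s sparseD[OF assms, of "s + a" "s + b"] sparseD[OF assms, of "s + b" "s + a"]
        by cases (auto simp: trace_def)
    qed
    then have single: "trace X s n = {a}" if "a \<in> trace X s n" for a using that by blast
    show "trace X s n = {}"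
    proof (rule equals0I)
      fix a assume a: "a \<in> trace X s n"
      then have "a < n" by (simp add: trace_def)
      with single[OF a] \<open>trace X s n \<notin> _\<close> show False by blast
    qed
  qed
  then have "card ((\<lambda>s. trace X s n) ` {P..}) \<le> card (insert {} ((\<lambda>k. {k}) ` {..<n}))"
    by (intro card_mono) auto
  also have "\<dots> \<le> Suc (card ((\<lambda>k. {k}) ` {..<n}))" by (rule card_insert_le_m1) auto
  also have "\<dots> \<le> n + 1" using card_image_le[of "{..<n}" "\<lambda>k. {k}"] by simp
  finally show ?thesis .
qed

section \<open>One scale\<close>

text \<open>
  The ones of \<open>(rev y) 0\<^sup>2\<^sup>a y\<close>, where \<open>T\<close> is the set of ones of \<open>y\<close>. The axis of symmetry lies between
  the positions \<open>c - 1\<close> and \<open>c\<close>.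
\<close>

definition mirror_block :: "nat \<Rightarrow> nat \<Rightarrow> nat set \<Rightarrow> nat set" where
  "mirror_block c a T = {k. \<exists>t\<in>T. k = c + a + t \<or> k + 1 + a + t = c}"

text \<open>
  One scale places a block for each pair of a pattern \<open>T \<in> \<T>\<close> and a number \<open>i < J\<close> to the right of the
  position \<open>P\<close>. The window length is \<open>6 * J\<close>. With \<open>a = 2 * J - i\<close>, a block reaches less than \<open>3 * J\<close> to either
  side of its centre. With centres at distance \<open>12 * J\<close>, no window meets two blocks, and the leading
  \<open>9 * J\<close> keeps the first \<open>6 * J\<close> positions of the scale free of ones.
\<close>

locale scale =
  fixes J g P :: nat and \<T> :: "nat set set"
  assumes J: "1 \<le> J" and gJ: "g \<le> J" and fin: "finite \<T>" and ne: "\<T> \<noteq> {}"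
    and zero: "T \<in> \<T> \<Longrightarrow> 0 \<in> T" and bound: "T \<in> \<T> \<Longrightarrow> T \<subseteq> {..<J}"
    and sp: "T \<in> \<T> \<Longrightarrow> sparse g T"
begin

definition N where "N = card (\<T> \<times> {..<J})"
definition enum where "enum = (SOME e. bij_betw e {..<N} (\<T> \<times> {..<J}))"

lemma enum: "bij_betw enum {..<N} (\<T> \<times> {..<J})"
proof -
  have "\<exists>e. bij_betw e {..<N} (\<T> \<times> {..<J})"
    unfolding N_def using fin by (metis atLeast0LessThan ex_bij_betw_nat_finite finite_SigmaI finite_lessThan)
  then show ?thesis unfolding enum_def by (rule someI_ex)
qed

definition centre where "centre l = P + 9 * J + 12 * J * l"
definition off where "off l = 2 * J - snd (enum l)"
definition pattern where "pattern l = fst (enum l)"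
definition V where "V = (\<Union>l<N. mirror_block (centre l) (off l) (pattern l))"
definition P' where "P' = P + 12 * J * N"

lemma N_pos: "N > 0"
  unfolding N_def using fin ne J by (simp add: card_gt_0_iff)

lemma enum_in: "l < N \<Longrightarrow> pattern l \<in> \<T> \<and> J < off l \<and> off l \<le> 2 * J \<and> snd (enum l) < J"
  using bij_betw_apply[OF enum, of l] by (auto simp: pattern_def off_def mem_Times_iff)

lemma block_range:
  assumes "l < N" "k \<in> mirror_block (centre l) (off l) (pattern l)"
  shows "centre l \<le> k + 3 * J" "k < centre l + 3 * J"
proof -
  obtain t where t: "t \<in> pattern l" "k = centre l + off l + t \<or> k + 1 + off l + t = centre l"
    using assms by (auto simp: mirror_block_def)
  have "t < J" using t bound enum_in[OF assms(1)] by auto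
  then show "centre l \<le> k + 3 * J" "k < centre l + 3 * J"
    using t(2) enum_in[OF assms(1)] by auto
qed

lemma centre_less:
  assumes "l < l'" shows "centre l + 12 * J \<le> centre l'"
proof -
  have "12 * J * Suc l \<le> 12 * J * l'" using assms by (intro mult_le_mono2) simp
  then show ?thesis by (simp add: centre_def)
qed

lemma centre_bounds: "P + 9 * J \<le> centre l" "l < N \<Longrightarrow> centre l + 3 * J \<le> P'"
proof -
  show "P + 9 * J \<le> centre l" by (simp add: centre_def)
  assume "l < N"
  then have "12 * J * Suc l \<le> 12 * J * N" by (intro mult_le_mono2) simp
  then show "centre l + 3 * J \<le> P'" by (simp add: centre_def P'_def)
qed

lemma P_less: "P < P'"
  using N_pos J by (simp add: P'_def)

lemma V_subset: "V \<subseteq> {P + 6 * J..<P'}"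
proof
  fix k assume "k \<in> V"
  then obtain l where l: "l < N" "k \<in> mirror_block (centre l) (off l) (pattern l)"
    by (auto simp: V_def)
  then show "k \<in> {P + 6 * J..<P'}"
    using block_range[OF l] centre_bounds(1)[of l] centre_bounds(2)[OF l(1)] by auto
qed

lemma V_nonempty: "V \<noteq> {}"
proof -
  have "centre 0 + off 0 + 0 \<in> mirror_block (centre 0) (off 0) (pattern 0)"
    unfolding mirror_block_def using zero enum_in[OF N_pos] by blast
  then show ?thesis using N_pos unfolding V_def by blast
qed

lemma V_sparse: "sparse g V"
  unfolding sparse_def
proof (intro ballI impI)
  fix a b assume "a \<in> V" "b \<in> V" and less: "a < b"
  then obtain l m where l: "l < N" "a \<in> mirror_block (centre l) (off l) (pattern l)"
    and m: "m < N" "b \<in> mirror_block (centre m) (off m) (pattern m)"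
    by (auto simp: V_def)
  consider "l < m" | "m < l" | "l = m" by linarith
  then show "a + g \<le> b"
  proof cases
    case 1
    then show ?thesis using block_range[OF l] block_range[OF m] centre_less[OF 1] gJ by linarith
  next
    case 2
    then show ?thesis using block_range[OF l] block_range[OF m] centre_less[OF 2] less by linarith
  next
    case 3
    have T: "pattern l \<in> \<T>" "J < off l" using enum_in[OF l(1)] by auto
    obtain t u where t: "t \<in> pattern l" "a = centre l + off l + t \<or> a + 1 + off l + t = centre l"
      and u: "u \<in> pattern l" "b = centre l + off l + u \<or> b + 1 + off l + u = centre l"
      using l(2) m(2) 3 by (auto simp: mirror_block_def)
    show ?thesis
      using t(2) u(2) less gJ T(2) sparseD[OF sp[OF T(1)] t(1) u(1)] sparseD[OF sp[OF T(1)] u(1) t(1)]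
      by auto
  qed
qed

text \<open>
  Centred windows are palindromes. They differ from each other: the innermost \<open>1\<close> reveals the offset,
  because every pattern contains \<open>0\<close>, and the offset gives access to the pattern.
\<close>

lemma palindromes_ge:
  assumes X: "X \<inter> {P..<P'} = V" 
  shows "card \<T> * J \<le> palindrome_complexity (char_word X) (6 * J)"
proof -
  define K where "K l = {k. \<exists>t\<in>pattern l. k = 3 * J + off l + t \<or> k + 1 + off l + t = 3 * J}" for l
  have tr: "trace X (centre l - 3 * J) (6 * J) = K l" if l: "l < N" for l
  proof -
    have *: "centre l - 3 * J + k \<in> X \<longleftrightarrow> k \<in> K l" if k: "k < 6 * J" for k
    proof -
      have rng: "centre l - 3 * J + k \<in> {P..<P'}"
        using centre_bounds(1)[of l] centre_bounds(2)[OF l] k by auto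
      then have "centre l - 3 * J + k \<in> X \<longleftrightarrow> centre l - 3 * J + k \<in> V" using X by blast
      also have "\<dots> \<longleftrightarrow> centre l - 3 * J + k \<in> mirror_block (centre l) (off l) (pattern l)"
      proof
        assume "centre l - 3 * J + k \<in> V"
        then obtain m where m: "m < N" "centre l - 3 * J + k \<in> mirror_block (centre m) (off m) (pattern m)"
          by (auto simp: V_def)
        have "\<not> l < m" "\<not> m < l"
          using block_range[OF m] k centre_less[of l m] centre_less[of m l] centre_bounds(1)[of l] J
          by linarith+
        then show "centre l - 3 * J + k \<in> mirror_block (centre l) (off l) (pattern l)" using m by simp
      qed (use l in \<open>auto simp: V_def\<close>)
      also have "\<dots> \<longleftrightarrow> k \<in> K l"
      proof -
        have "(centre l - 3 * J + k = centre l + off l + t \<or> centre l - 3 * J + k + 1 + off l + t = centre l)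
            \<longleftrightarrow> (k = 3 * J + off l + t \<or> k + 1 + off l + t = 3 * J)" for t
          using centre_bounds(1)[of l] by linarith
        then show ?thesis unfolding mirror_block_def K_def by simp
      qed
      finally show ?thesis .
    qed
    have "k < 6 * J" if "k \<in> K l" for k
      using that bound enum_in[OF l] by (fastforce simp: K_def)
    then show ?thesis using * by (auto simp: trace_def)
  qed
  have sym: "mirror_symmetric (6 * J) (K l)" for l
    unfolding mirror_symmetric_def
  proof (intro allI impI)
    fix k assume "k < 6 * J"
    then have "(6 * J - 1 - k = 3 * J + off l + t \<or> 6 * J - 1 - k + 1 + off l + t = 3 * J)
        \<longleftrightarrow> (k = 3 * J + off l + t \<or> k + 1 + off l + t = 3 * J)" for t
      by linarith
    then show "6 * J - 1 - k \<in> K l \<longleftrightarrow> k \<in> K l" unfolding K_def mem_Collect_eq by (simp only:)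
  qed
  have "inj_on K {..<N}"
  proof (rule inj_onI)
    fix l m assume lm: "l \<in> {..<N}" "m \<in> {..<N}" and eq: "K l = K m"
    have le: "off m \<le> off l" if "l < N" "m < N" "K l = K m" for l m
    proof -
      have "3 * J + off l + 0 \<in> K l" unfolding K_def using zero enum_in[OF that(1)] by blast
      then have "3 * J + off l \<in> K m" using that(3) by simp
      then show ?thesis by (auto simp: K_def)
    qed
    have off: "off l = off m" using le[of l m] le[of m l] lm eq by simp
    have mem: "t \<in> pattern l \<longleftrightarrow> 3 * J + off l + t \<in> K l" for l t by (auto simp: K_def)
    have "t \<in> pattern l \<longleftrightarrow> t \<in> pattern m" for t
      using mem[of t l] mem[of t m] off eq by simp
    then have "pattern l = pattern m" by blast
    moreover have "snd (enum l) = snd (enum m)"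
      using off enum_in[of l] enum_in[of m] lm by (auto simp: off_def)
    ultimately have "enum l = enum m" by (simp add: pattern_def prod_eq_iff)
    then show "l = m" using enum lm by (simp add: bij_betw_def inj_on_def)
  qed
  then have "N = card (K ` {..<N})" by (simp add: card_image)
  also have "\<dots> \<le> palindrome_complexity (char_word X) (6 * J)"
    unfolding palindrome_complexity_char_word
  proof (rule card_mono)
    show "K ` {..<N} \<subseteq> {K \<in> range (\<lambda>s. trace X s (6 * J)). mirror_symmetric (6 * J) K}"
    proof clarify
      fix l assume "l < N"
      then have "K l = trace X (centre l - 3 * J) (6 * J)" using tr by simp
      then show "K l \<in> range (\<lambda>s. trace X s (6 * J)) \<and> mirror_symmetric (6 * J) (K l)"
        using sym[of l] by blast
    qed
    show "finite {K \<in> range (\<lambda>s. trace X s (6 * J)). mirror_symmetric (6 * J) K}"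
      by (rule finite_subset[OF _ finite_range_trace[of X "6 * J" UNIV]]) blast
  qed
  finally show ?thesis by (simp add: N_def card_cartesian_product)
qed

text \<open>
  The positions of a scale split into cells of length \<open>12 * J\<close>, each from \<open>9 * J\<close> before a centre to
  \<open>3 * J\<close> after it. A window starting in a cell meets at most the block of this cell; \<open>r\<close> is its
  position within the cell.
\<close>

lemma trace_in_scale:
  assumes X: "X \<inter> {P..<P'} = V" "X \<inter> {P'..<P' + 6 * J} = {}" and s: "P \<le> s" "s < P'"
  obtains T i r where "T \<in> \<T>" "i < J" "r < 12 * J"
    "trace X s (6 * J) = {k. k < 6 * J \<and> r + k \<in> mirror_block (9 * J) (2 * J - i) T}"
proof -
  define l where "l = (s - P) div (12 * J)"
  define r where "r = (s - P) mod (12 * J)"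
  have sr: "s = P + 12 * J * l + r" using s(1) by (simp add: l_def r_def)
  have r: "r < 12 * J" using J by (simp add: r_def)
  have l: "l < N"
    using s J unfolding l_def P'_def by (simp add: less_mult_imp_div_less mult.commute less_diff_conv2)
  have sc: "s + 9 * J = centre l + r" by (simp add: sr centre_def)
  have "s + k \<in> X \<longleftrightarrow> r + k \<in> mirror_block (9 * J) (off l) (pattern l)" if k: "k < 6 * J" for k
  proof -
    have "s + k \<in> X \<longleftrightarrow> s + k \<in> V"
    proof (cases "s + k < P'")
      case True
      then have "s + k \<in> {P..<P'}" using s(1) by simp
      then show ?thesis using X(1) by blast
    next
      case False
      then have "s + k \<in> {P'..<P' + 6 * J}" using s(2) k by simp
      then have "s + k \<notin> X" using X(2) by blast
      moreover have "s + k \<notin> V" using False V_subset by auto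
      ultimately show ?thesis by simp
    qed
    also have "\<dots> \<longleftrightarrow> s + k \<in> mirror_block (centre l) (off l) (pattern l)"
    proof
      assume "s + k \<in> V"
      then obtain m where m: "m < N" "s + k \<in> mirror_block (centre m) (off m) (pattern m)"
        by (auto simp: V_def)
      have "\<not> l < m" "\<not> m < l"
        using block_range[OF m] k r sc centre_less[of l m] centre_less[of m l] by linarith+
      then show "s + k \<in> mirror_block (centre l) (off l) (pattern l)" using m by simp
    qed (use l in \<open>auto simp: V_def\<close>)
    also have "\<dots> \<longleftrightarrow> r + k \<in> mirror_block (9 * J) (off l) (pattern l)"
    proof -
      have "(s + k = centre l + off l + t \<or> s + k + 1 + off l + t = centre l)
          \<longleftrightarrow> (r + k = 9 * J + off l + t \<or> r + k + 1 + off l + t = 9 * J)" for t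
        using sc by linarith
      then show ?thesis unfolding mirror_block_def by simp
    qed
    finally show ?thesis .
  qed
  then have "trace X s (6 * J) = {k. k < 6 * J \<and> r + k \<in> mirror_block (9 * J) (2 * J - snd (enum l)) (pattern l)}"
    by (auto simp: trace_def off_def)
  then show ?thesis using that[of "pattern l" "snd (enum l)" r] enum_in[OF l] r by blast
qed

text \<open>
  If only one half of the block is visible, the trace depends on \<open>r\<close> and \<open>i\<close> only through a single
  number, so there are linearly many such traces for each pattern. Quadratically many arise if both
  halves are visible.
\<close>

lemma card_traces_in_scale:
  assumes X: "X \<inter> {P..<P'} = V" "X \<inter> {P'..<P' + 6 * J} = {}"
  shows "card ((\<lambda>s. trace X s (6 * J)) ` {P..<P'}) \<le> 31 * J\<^sup>2 * card \<T>"
proof -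
  (* R: starting after the left half of the block; L: ending before its right half; M: the rest *)
  define R where "R = (\<lambda>(T, u). {k. k < 6 * J \<and> (\<exists>t\<in>T. u + k = 11 * J + t)}) ` (\<T> \<times> {..<13 * J})"
  define L where "L = (\<lambda>(T, u). {k. k < 6 * J \<and> (\<exists>t\<in>T. u + k + 1 + t = 9 * J)}) ` (\<T> \<times> {..<14 * J})"
  define M where "M = (\<lambda>(T, i, v). {k. k < 6 * J \<and> 5 * J - i + 1 + v + k \<in> mirror_block (9 * J) (2 * J - i) T})
      ` (\<T> \<times> {..<J} \<times> {..<4 * J})"
  have "(\<lambda>s. trace X s (6 * J)) ` {P..<P'} \<subseteq> R \<union> L \<union> M"
  proof
    fix K assume "K \<in> (\<lambda>s. trace X s (6 * J)) ` {P..<P'}"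
    then obtain s where s: "P \<le> s" "s < P'" "K = trace X s (6 * J)" by auto
    obtain T i r where T: "T \<in> \<T>" "i < J" "r < 12 * J"
      and K: "K = {k. k < 6 * J \<and> r + k \<in> mirror_block (9 * J) (2 * J - i) T}"
      using trace_in_scale[OF X s(1,2)] s(3) by metis
    consider "9 * J \<le> r + (2 * J - i)" | "r + 6 * J \<le> 9 * J + (2 * J - i)"
      | "r + (2 * J - i) < 9 * J" "9 * J + (2 * J - i) < r + 6 * J"
      by linarith
    then show "K \<in> R \<union> L \<union> M"
    proof cases
      case 1
      have "(r + k = 9 * J + (2 * J - i) + t \<or> r + k + 1 + (2 * J - i) + t = 9 * J)
          \<longleftrightarrow> r + i + k = 11 * J + t" for k t
        using 1 T(2) by auto
      then have "K = {k. k < 6 * J \<and> (\<exists>t\<in>T. r + i + k = 11 * J + t)}"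
        unfolding K mirror_block_def by simp
      moreover have "r + i < 13 * J" using T by simp
      ultimately have "K \<in> R" unfolding R_def using T(1) by (intro image_eqI[of _ _ "(T, r + i)"]) auto
      then show ?thesis by simp
    next
      case 2
      have "(r + k = 9 * J + (2 * J - i) + t \<or> r + k + 1 + (2 * J - i) + t = 9 * J)
          \<longleftrightarrow> r + (2 * J - i) + k + 1 + t = 9 * J" if "k < 6 * J" for k t
        using 2 T(2) that by auto
      then have "K = {k. k < 6 * J \<and> (\<exists>t\<in>T. r + (2 * J - i) + k + 1 + t = 9 * J)}"
        unfolding K mirror_block_def by auto
      moreover have "r + (2 * J - i) < 14 * J" using T by simp
      ultimately have "K \<in> L" unfolding L_def using T(1) by (intro image_eqI[of _ _ "(T, r + (2 * J - i))"]) auto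
      then show ?thesis by simp
    next
      case 3
      define v where "v = r - (5 * J - i + 1)"
      have v: "r = 5 * J - i + 1 + v" "v < 4 * J" using 3 T by (auto simp: v_def)
      have "K \<in> M" unfolding M_def using T v K by (intro image_eqI[of _ _ "(T, i, v)"]) auto
      then show ?thesis by simp
    qed
  qed
  moreover have finR: "finite R" and finL: "finite L" and finM: "finite M"
    unfolding R_def L_def M_def using fin by auto
  ultimately have "card ((\<lambda>s. trace X s (6 * J)) ` {P..<P'}) \<le> card (R \<union> L \<union> M)"
    by (intro card_mono) auto
  also have "\<dots> \<le> card R + card L + card M"
    using card_Un_le[of "R \<union> L" M] card_Un_le[of R L] by simp
  also have "\<dots> \<le> card \<T> * (13 * J) + card \<T> * (14 * J) + card \<T> * (J * (4 * J))"
  proof (intro add_mono)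
    show "card R \<le> card \<T> * (13 * J)" unfolding R_def
      by (rule order_trans[OF card_image_le]) (use fin in \<open>auto simp: card_cartesian_product\<close>)
    show "card L \<le> card \<T> * (14 * J)" unfolding L_def
      by (rule order_trans[OF card_image_le]) (use fin in \<open>auto simp: card_cartesian_product\<close>)
    show "card M \<le> card \<T> * (J * (4 * J))" unfolding M_def
      by (rule order_trans[OF card_image_le]) (use fin in \<open>auto simp: card_cartesian_product\<close>)
  qed
  also have "\<dots> = card \<T> * (27 * J + 4 * J\<^sup>2)" by (simp add: algebra_simps power2_eq_square)
  also have "\<dots> \<le> card \<T> * (31 * J\<^sup>2)"
    using J by (intro mult_le_mono2) (simp add: power2_eq_square)
  finally show ?thesis by (simp add: mult_ac)
qed

lemma complexity_le:
  assumes X: "X \<inter> {P..<P'} = V" "X \<inter> {P'..<P' + 6 * J} = {}" and sparse: "sparse (6 * J) (X \<inter> {P'..})"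
  shows "factor_complexity (char_word X) (6 * J) \<le> 38 * J\<^sup>2 * card \<T> + P"
proof -
  let ?t = "\<lambda>s. trace X s (6 * J)"
  have "range ?t = ?t ` {..<P} \<union> ?t ` {P..<P'} \<union> ?t ` {P'..}"
    unfolding image_Un[symmetric] using P_less by (intro arg_cong[where f = "\<lambda>S. ?t ` S"]) auto
  then have "card (range ?t) \<le> card (?t ` {..<P}) + card (?t ` {P..<P'}) + card (?t ` {P'..})"
    using card_Un_le[of "?t ` {..<P} \<union> ?t ` {P..<P'}" "?t ` {P'..}"]
      card_Un_le[of "?t ` {..<P}" "?t ` {P..<P'}"] by simp
  also have "\<dots> \<le> P + 31 * J\<^sup>2 * card \<T> + (6 * J + 1)"
    using card_image_le[of "{..<P}" ?t]
    by (intro add_mono card_traces_in_scale[OF X] card_sparse_traces[OF sparse]) auto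
  also have "6 * J + 1 \<le> 7 * J\<^sup>2 * card \<T>"
  proof -
    have "card \<T> \<ge> 1" using fin ne by (simp add: Suc_leI card_gt_0_iff)
    then have "J * J * 1 \<le> J * J * card \<T>" by (rule mult_le_mono2)
    moreover have "J * 1 \<le> J * J" using J by (rule mult_le_mono2)
    ultimately have "J \<le> J * J * card \<T>" by simp
    then show ?thesis using J unfolding power2_eq_square by linarith
  qed
  finally show ?thesis by (simp add: factor_complexity_char_word algebra_simps)
qed

end

text \<open>
  The number \<open>h\<close> of free positions is the least one for which the scale has at least \<open>t\<close> palindromes.
  Then \<open>J * 2 ^ h\<close> exceeds \<open>t\<close> at most by a factor \<open>4\<close>, and the complexity is at most a multiple of
  \<open>g * t * ln (t + 1)\<close>. The threshold for \<open>f t\<close> may contain the factor \<open>g\<close>, because \<open>g\<close> and \<open>P\<close> are known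
  before \<open>t\<close> is chosen. The hypotheses on \<open>X\<close> say what the scales after this one may look like.
\<close>

lemma ex_scale_with_large_ratio:
  fixes f :: "nat \<Rightarrow> real"
  assumes "mono f" and unb: "\<And>B T. \<exists>t\<ge>T. f t > B * (real t * ln (real t + 1))"
    and "M \<ge> 0" and g: "g \<ge> 1"
  shows "\<exists>V P' n. g < n \<and> P < P' \<and> V \<noteq> {} \<and> V \<subseteq> {P + g..<P'} \<and> sparse g V \<and>
    (\<forall>X. X \<inter> {P..<P'} = V \<longrightarrow> X \<inter> {P'..<P' + n} = {} \<longrightarrow> sparse n (X \<inter> {P'..}) \<longrightarrow>
      f (palindrome_complexity (char_word X) n) > M * real (factor_complexity (char_word X) n))"
proof -
  obtain t where t: "t \<ge> P + g + 1" "f t > 765 * real g * M * (real t * ln (real t + 1))"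
    using unb by blast
  define h where "h = (LEAST h. t \<le> g * (h + 1) * 2 ^ h)"
  have "1 * (t + 1) * 1 \<le> g * (t + 1) * 2 ^ t"
    using g by (intro mult_le_mono) auto
  then have h_ge: "t \<le> g * (h + 1) * 2 ^ h"
    unfolding h_def by (intro LeastI[of "\<lambda>h. t \<le> g * (h + 1) * 2 ^ h" t]) simp
  have "h \<noteq> 0" using h_ge t(1) by (intro notI) simp
  then obtain h' where h': "h = Suc h'" using not0_implies_Suc by blast
  have h'_less: "g * (h' + 1) * 2 ^ h' < t"
    using not_less_Least[of h' "\<lambda>h. t \<le> g * (h + 1) * 2 ^ h"] h' unfolding h_def by simp
  define J where "J = g * (h + 1)"
  define \<T> where "\<T> = (\<lambda>U. (*) g ` insert 0 U) ` Pow {1..h}"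
  have "inj_on (\<lambda>U. (*) g ` insert 0 U) (Pow {1..h})"
  proof (rule inj_onI)
    fix U W assume "U \<in> Pow {1..h}" "W \<in> Pow {1..h}" "(*) g ` insert 0 U = (*) g ` insert 0 W"
    moreover from this have "0 \<notin> U" "0 \<notin> W" by auto
    moreover have "inj ((*) g)" using g by (intro injI) simp
    ultimately have "insert 0 U = insert 0 W" by (simp only: inj_image_eq_iff)
    then show "U = W" by (simp only: insert_ident[OF \<open>0 \<notin> U\<close> \<open>0 \<notin> W\<close>])
  qed
  then have card: "card \<T> = 2 ^ h" by (simp add: \<T>_def card_image card_Pow)
  interpret scale J g P \<T>
  proof
    show "1 \<le> J" "g \<le> J" using g by (auto simp: J_def)
    show "finite \<T>" "\<T> \<noteq> {}" by (auto simp: \<T>_def)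
    fix T assume "T \<in> \<T>"
    then obtain U where U: "U \<subseteq> {1..h}" "T = (*) g ` insert 0 U" by (auto simp: \<T>_def)
    show "0 \<in> T" using U by auto
    show "T \<subseteq> {..<J}"
    proof
      fix k assume "k \<in> T"
      then obtain u where u: "k = g * u" "u \<in> insert 0 U" using U(2) by blast
      then have "u \<le> h" using U(1) by auto
      then have "g * u < g * (h + 1)" using g by (intro mult_less_mono2) auto
      then show "k \<in> {..<J}" by (simp only: u(1) J_def lessThan_iff)
    qed
    show "sparse g T"
      unfolding sparse_def
    proof (intro ballI impI)
      fix a b assume "a \<in> T" "b \<in> T" "a < b"
      then obtain u w where "a = g * u" "b = g * w" "g * u < g * w" using U(2) by blast
      then have "g * Suc u \<le> g * w" by (intro mult_le_mono2) simp
      then show "a + g \<le> b" using \<open>a = g * u\<close> \<open>b = g * w\<close> by simp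
    qed
  qed
  have J2h: "J * 2 ^ h \<le> 4 * t"
  proof -
    have "J * 2 ^ h = g * (h' + 2) * 2 * 2 ^ h'" by (simp add: J_def h')
    also have "\<dots> \<le> g * (2 * (h' + 1)) * 2 * 2 ^ h'" by (intro mult_le_mono) auto
    also have "\<dots> = 4 * (g * (h' + 1) * 2 ^ h')" by simp
    also have "\<dots> \<le> 4 * t" using h'_less by simp
    finally show ?thesis .
  qed
  have hlog: "real h + 1 \<le> 5 * ln (real t + 1)"
  proof -
    have "1 * 2 ^ h' \<le> g * (h' + 1) * 2 ^ h'" using g by (intro mult_le_mono1) simp
    also note h'_less
    finally have "2 ^ h' \<le> t" by simp
    then have "real (2 ^ h') \<le> real t" by (simp only: of_nat_le_iff)
    then have "(2 :: real) ^ h' \<le> real t + 1"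
      unfolding of_nat_power of_nat_numeral by linarith
    then have "ln (2 ^ h') \<le> ln (real t + 1)" by simp
    then have 1: "real h' * ln 2 \<le> ln (real t + 1)" by (simp add: ln_realpow)
    have "real h' * (2 / 3) \<le> real h' * ln 2"
      using ln2_ge_two_thirds by (intro mult_left_mono) auto
    with 1 have "real h' * (2 / 3) \<le> ln (real t + 1)" by (rule order_trans[rotated])
    moreover have "ln 2 \<le> ln (real t + 1)" using t(1) by (subst ln_le_cancel_iff) auto
    then have "2 / 3 \<le> ln (real t + 1)" using ln2_ge_two_thirds by (rule order_trans[rotated])
    moreover have "real h = real h' + 1" by (simp add: h')
    ultimately show ?thesis by argo
  qed
  have main: "f (palindrome_complexity (char_word X) (6 * J)) > M * real (factor_complexity (char_word X) (6 * J))"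
    if X: "X \<inter> {P..<P'} = V" "X \<inter> {P'..<P' + 6 * J} = {}" "sparse (6 * J) (X \<inter> {P'..})" for X
  proof -
    have "t \<le> palindrome_complexity (char_word X) (6 * J)"
      using palindromes_ge[OF X(1)] h_ge by (simp add: card J_def mult_ac)
    then have fle: "f t \<le> f (palindrome_complexity (char_word X) (6 * J))"
      using assms(1) by (simp add: monoD)
    have "factor_complexity (char_word X) (6 * J) \<le> 38 * J\<^sup>2 * 2 ^ h + P"
      using complexity_le[OF X] by (simp add: card)
    also have "38 * J\<^sup>2 * 2 ^ h + P = 38 * J * (J * 2 ^ h) + P" by (simp add: power2_eq_square)
    also have "\<dots> \<le> 38 * J * (4 * t) + P" using J2h by (intro add_right_mono mult_le_mono2)
    also have "38 * J * (4 * t) + P \<le> 153 * (J * t)"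
    proof -
      have "t \<le> J * t" using mult_le_mono1[OF J, of t] by (simp only: mult_1)
      with t(1) have "P \<le> J * t" by linarith
      moreover have "38 * J * (4 * t) = 152 * (J * t)" by simp
      ultimately show ?thesis by linarith
    qed
    finally have "real (factor_complexity (char_word X) (6 * J)) \<le> real (153 * (J * t))"
      by (rule of_nat_mono)
    also have "\<dots> = 153 * real g * real t * (real h + 1)" by (simp add: J_def algebra_simps)
    also have "\<dots> \<le> 153 * real g * real t * (5 * ln (real t + 1))"
      using hlog by (intro mult_left_mono) auto
    finally have "M * real (factor_complexity (char_word X) (6 * J))
        \<le> M * (153 * real g * real t * (5 * ln (real t + 1)))"
      using assms(3) by (rule mult_left_mono)
    also have "\<dots> = 765 * real g * M * (real t * ln (real t + 1))" by simp
    also have "\<dots> < f t" by (rule t(2))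
    finally show ?thesis using fle by simp
  qed
  have "g < 6 * J" using J gJ by linarith
  moreover have "V \<subseteq> {P + g..<P'}" using V_subset \<open>g < 6 * J\<close> by auto
  ultimately show ?thesis
    using P_less V_nonempty V_sparse main by blast
qed

section \<open>Combining the scales\<close>

text \<open>
  The gap \<open>g (Suc k)\<close> of the next scale is also the window length used at scale \<open>k\<close>. For this reason
  the sparseness of each tail is what the scale before it needs.
\<close>

locale scales =
  fixes P g :: "nat \<Rightarrow> nat" and V :: "nat \<Rightarrow> nat set"
  assumes g_less: "\<And>k. g k < g (Suc k)" and P_less: "\<And>k. P k < P (Suc k)"
    and V_ne: "\<And>k. V k \<noteq> {}" and V_sub: "\<And>k. V k \<subseteq> {P k + g k..<P (Suc k)}"
    and V_sparse: "\<And>k. sparse (g k) (V k)"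
begin

definition X where "X = (\<Union>k. V k)"

lemma g_mono: "strict_mono g" and P_mono: "strict_mono P"
  using g_less P_less by (auto simp: strict_mono_Suc_iff)

lemma V_bounds: "z \<in> V i \<Longrightarrow> P i + g i \<le> z \<and> z < P (Suc i)"
  using V_sub[of i] by auto

lemma V_index: "z \<in> V i \<Longrightarrow> P k \<le> z \<Longrightarrow> k \<le> i"
  using V_bounds[of z i] strict_mono_less_eq[OF P_mono, of "Suc i" k] by linarith

lemma X_scale: "X \<inter> {P k..<P (Suc k)} = V k"
proof
  show "X \<inter> {P k..<P (Suc k)} \<subseteq> V k"
  proof
    fix z assume z: "z \<in> X \<inter> {P k..<P (Suc k)}"
    then obtain i where i: "z \<in> V i" by (auto simp: X_def)
    have "k \<le> i" using V_index[OF i] z by simp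
    moreover have "\<not> Suc k \<le> i"
      using V_bounds[OF i] z strict_mono_less_eq[OF P_mono, of "Suc k" i] by auto
    ultimately have "i = k" by simp
    then show "z \<in> V k" using i by simp
  qed
  show "V k \<subseteq> X \<inter> {P k..<P (Suc k)}" using V_sub[of k] by (auto simp: X_def)
qed

lemma X_gap: "X \<inter> {P k..<P k + g k} = {}"
proof (rule equals0I)
  fix z assume z: "z \<in> X \<inter> {P k..<P k + g k}"
  then obtain i where i: "z \<in> V i" by (auto simp: X_def)
  have "k \<le> i" using V_index[OF i] z by simp
  then have "P k \<le> P i" "g k \<le> g i" using P_mono g_mono by (simp_all add: strict_mono_less_eq)
  then show False using V_bounds[OF i] z by auto
qed

lemma X_sparse: "sparse (g k) (X \<inter> {P k..})"
  unfolding sparse_def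
proof (intro ballI impI)
  fix a b assume a: "a \<in> X \<inter> {P k..}" and b: "b \<in> X \<inter> {P k..}" and less: "a < b"
  obtain i j where i: "a \<in> V i" and j: "b \<in> V j" using a b by (auto simp: X_def)
  have k: "k \<le> i" "k \<le> j" using V_index[OF i] V_index[OF j] a b by auto
  have gk: "g k \<le> g i" "g k \<le> g j" using k g_mono by (simp_all add: strict_mono_less_eq)
  consider "i < j" | "i = j" | "j < i" by linarith
  then show "a + g k \<le> b"
  proof cases
    case 1
    then have "P (Suc i) \<le> P j" using P_mono by (simp add: strict_mono_less_eq)
    then show ?thesis using V_bounds[OF i] V_bounds[OF j] gk by linarith
  next
    case 2
    then show ?thesis using sparseD[OF V_sparse, of a i b] i j less gk by simp
  next
    case 3
    then have "P (Suc j) \<le> P i" using P_mono by (simp add: strict_mono_less_eq)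
    then show ?thesis using V_bounds[OF i] V_bounds[OF j] less by linarith
  qed
qed

text \<open>
  There are infinitely many ones, and the distances between consecutive ones tend to infinity.
\<close>

lemma not_ultimately_periodic: "\<not> ultimately_periodic (char_word X)"
proof
  assume "ultimately_periodic (char_word X)"
  then obtain T N where T: "T \<ge> 1" "\<And>i. i \<ge> N \<Longrightarrow> char_word X (i + T) = char_word X i"
    by (auto simp: ultimately_periodic_def)
  define k where "k = T + N + 1"
  obtain a where a: "a \<in> V k" using V_ne by blast
  have k: "k \<le> P k" "k \<le> g k"
    using strict_mono_imp_increasing[OF P_mono] strict_mono_imp_increasing[OF g_mono] by auto
  have aX: "a \<in> X" "a \<ge> P k" using a V_bounds[OF a] by (auto simp: X_def)
  then have "a + T \<in> X"
    using T(2)[of a] k by (simp add: char_word_def k_def split: if_splits)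
  then have "a + g k \<le> a + T"
    using sparseD[OF X_sparse[of k], of a "a + T"] aX T(1) by simp
  then show False using k by (simp add: k_def)
qed

end

theorem ex_word_with_many_palindromes:
  fixes f :: "nat \<Rightarrow> real"
  assumes "mono f" and unb: "\<And>B T. \<exists>t\<ge>T. f t > B * (real t * ln (real t + 1))"
  shows "\<exists>X. \<not> ultimately_periodic (char_word X) \<and>
    limsup (\<lambda>n. ereal (f (palindrome_complexity (char_word X) n) / real (factor_complexity (char_word X) n))) = \<infinity>"
proof -
  define step where "step k s s' V \<longleftrightarrow> (case (s, s') of ((P, g), (P', n)) \<Rightarrow>
      g < n \<and> P < P' \<and> V \<noteq> {} \<and> V \<subseteq> {P + g..<P'} \<and> sparse g V \<and>
      (\<forall>X. X \<inter> {P..<P'} = V \<longrightarrow> X \<inter> {P'..<P' + n} = {} \<longrightarrow> sparse n (X \<inter> {P'..}) \<longrightarrow>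
        f (palindrome_complexity (char_word X) n) > real k * real (factor_complexity (char_word X) n)))"
    for k :: nat and s s' :: "nat \<times> nat" and V :: "nat set"
  have "\<exists>s. \<forall>k. snd (s k) \<ge> 1 \<and> (\<exists>V. step k (s k) (s (Suc k)) V)"
  proof (rule dependent_nat_choice[where P = "\<lambda>_ s. 1 \<le> snd s" and Q = "\<lambda>k s s'. \<exists>V. step k s s' V"])
    show "\<exists>s :: nat \<times> nat. 1 \<le> snd s" by (rule exI[of _ "(0, 1)"]) simp
    fix s :: "nat \<times> nat" and k :: nat assume s: "1 \<le> snd s"
    obtain P g where Pg: "s = (P, g)" by fastforce
    obtain V P' n where "step k s (P', n) V"
      using ex_scale_with_large_ratio[OF assms, of "real k" g P] s Pg unfolding step_def by auto
    moreover from this have "1 \<le> n" by (simp add: step_def Pg)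
    ultimately show "\<exists>s'. 1 \<le> snd s' \<and> (\<exists>V. step k s s' V)" by fastforce
  qed
  then obtain s V where sV: "\<And>k. step k (s k) (s (Suc k)) (V k)" by metis
  define P g where "P = fst \<circ> s" and "g = snd \<circ> s"
  have step: "g k < g (Suc k) \<and> P k < P (Suc k) \<and> V k \<noteq> {} \<and> V k \<subseteq> {P k + g k..<P (Suc k)} \<and> sparse (g k) (V k) \<and>
      (\<forall>X. X \<inter> {P k..<P (Suc k)} = V k \<longrightarrow> X \<inter> {P (Suc k)..<P (Suc k) + g (Suc k)} = {} \<longrightarrow>
        sparse (g (Suc k)) (X \<inter> {P (Suc k)..}) \<longrightarrow>
        f (palindrome_complexity (char_word X) (g (Suc k))) > real k * real (factor_complexity (char_word X) (g (Suc k))))" for k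
    using sV[of k] by (simp add: step_def P_def g_def case_prod_beta)
  interpret scales P g V
    by unfold_locales (use step in blast)+
  let ?u = "\<lambda>n. ereal (f (palindrome_complexity (char_word X) n) / real (factor_complexity (char_word X) n))"
  have ratio: "?u (g (Suc k)) \<ge> ereal (real k)" for k
  proof -
    let ?\<rho> = "real (factor_complexity (char_word X) (g (Suc k)))"
    have "real k * ?\<rho> < f (palindrome_complexity (char_word X) (g (Suc k)))"
      using step[of k] X_scale[of k] X_gap[of "Suc k"] X_sparse[of "Suc k"] by blast
    moreover have "?\<rho> > 0"
      unfolding factor_complexity_char_word by (auto simp: card_gt_0_iff)
    ultimately show ?thesis by (simp add: pos_le_divide_eq less_imp_le)
  qed
  have "(\<lambda>k. ?u (g (Suc k))) \<longlonglongrightarrow> \<infinity>"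
  proof (rule tendsto_sandwich[OF always_eventually always_eventually _ tendsto_const])
    show "\<forall>k. ereal (real k) \<le> ?u (g (Suc k))" using ratio by blast
    show "(\<lambda>k. ereal (real k)) \<longlonglongrightarrow> \<infinity>"
      by (simp add: tendsto_PInfty_eq_at_top filterlim_real_sequentially)
  qed simp
  then have "limsup (?u \<circ> (\<lambda>k. g (Suc k))) = \<infinity>"
    by (simp add: lim_imp_Limsup comp_def)
  moreover have "strict_mono (\<lambda>k. g (Suc k))" using g_mono by (simp add: strict_mono_def)
  ultimately have "limsup ?u = \<infinity>"
    using limsup_subseq_mono[of "\<lambda>k. g (Suc k)" ?u] by simp
  then show ?thesis using not_ultimately_periodic by blast
qed

section \<open>The equivalence and its sharpness\<close>

theorem theorem12:
  fixes f :: "nat \<Rightarrow> real"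
  assumes "mono f" and "\<forall>t. f t \<ge> 0"
  shows "((\<forall>(A :: nat set) (x :: nat \<Rightarrow> nat).
            finite A \<longrightarrow> range x \<subseteq> A \<longrightarrow> \<not> ultimately_periodic x \<longrightarrow>
            (\<lambda>n. f (palindrome_complexity x n) / real (factor_complexity x n)) \<longlonglongrightarrow> 0)
          \<longleftrightarrow> f \<in> O[at_top](\<lambda>t. real t * ln (real t + 1)))
       \<and> (\<not> bounded ((\<lambda>t. f t / (real t * ln (real t + 1))) ` {t. t \<ge> 1}) \<longrightarrow>
          (\<exists>(A :: nat set) (x :: nat \<Rightarrow> nat).
            finite A \<and> range x \<subseteq> A \<and> \<not> ultimately_periodic x \<and>
            limsup (\<lambda>n. ereal (f (palindrome_complexity x n) / real (factor_complexity x n))) = \<infinity>))"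
proof -
  let ?g = "\<lambda>t. real t * ln (real t + 1)"
  have bigO: "\<exists>c T. \<forall>t\<ge>T. f t \<le> c * ?g t" if O: "f \<in> O[at_top](?g)"
  proof -
    obtain c where "eventually (\<lambda>t. norm (f t) \<le> c * norm (?g t)) at_top"
      using O by (elim landau_o.bigE)
    then obtain T where T: "\<And>t. t \<ge> T \<Longrightarrow> norm (f t) \<le> c * norm (?g t)"
      unfolding eventually_at_top_linorder by blast
    have "norm (?g t) = ?g t" for t by simp
    then have "\<forall>t\<ge>T. f t \<le> c * ?g t" using T by (metis abs_ge_self order_trans real_norm_def)
    then show ?thesis by blast
  qed
  have small: "(\<lambda>n. f (palindrome_complexity x n) / real (factor_complexity x n)) \<longlonglongrightarrow> 0"
    if O: "f \<in> O[at_top](?g)" and "finite A" "range x \<subseteq> A" "\<not> ultimately_periodic x"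
    for A and x :: "nat \<Rightarrow> nat"
  proof -
    interpret finite_word A x using that by unfold_locales
    obtain c T where cT: "\<And>t. t \<ge> T \<Longrightarrow> f t \<le> c * ?g t" using bigO[OF O] by blast
    have f_le: "f t \<le> f T + \<bar>c\<bar> * ?g t" for t
    proof (cases "t \<ge> T")
      case True
      have "c * ?g t \<le> \<bar>c\<bar> * ?g t" by (intro mult_right_mono) auto
      then show ?thesis using cT[OF True] assms(2)[rule_format, of T] by linarith
    next
      case False
      then have "f t \<le> f T" using assms(1) by (simp add: monoD)
      moreover have "0 \<le> \<bar>c\<bar> * ?g t" by simp
      ultimately show ?thesis by linarith
    qed
    have "filterlim (\<lambda>n. real (\<rho> n)) at_top sequentially"
    proof (rule filterlim_at_top_mono[OF filterlim_real_sequentially])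
      show "\<forall>\<^sub>F n in sequentially. real n \<le> real (\<rho> n)"
        using complexity_gt[OF that(4)] by (intro always_eventually) (auto intro: less_imp_le)
    qed
    then have "(\<lambda>n. f T / real (\<rho> n)) \<longlonglongrightarrow> 0"
      by (intro real_tendsto_divide_at_top[OF tendsto_const])
    moreover have "(\<lambda>n. \<bar>c\<bar> * (?g (p n) / real (\<rho> n))) \<longlonglongrightarrow> 0"
      using palindromes_log_tendsto_0[OF that(4)] by (intro tendsto_mult_right_zero)
    ultimately have lim: "(\<lambda>n. f T / real (\<rho> n) + \<bar>c\<bar> * (?g (p n) / real (\<rho> n))) \<longlonglongrightarrow> 0"
      using tendsto_add by fastforce
    have le: "norm (f (p n) / real (\<rho> n)) \<le> f T / real (\<rho> n) + \<bar>c\<bar> * (?g (p n) / real (\<rho> n))" for n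
    proof -
      have "f (p n) / real (\<rho> n) \<le> (f T + \<bar>c\<bar> * ?g (p n)) / real (\<rho> n)"
        using f_le by (intro divide_right_mono) auto
      then show ?thesis using assms(2) by (simp add: add_divide_distrib)
    qed
    show ?thesis by (rule Lim_null_comparison[OF always_eventually[OF allI[OF le]] lim])
  qed
  have large: "\<exists>(A :: nat set) (x :: nat \<Rightarrow> nat). finite A \<and> range x \<subseteq> A \<and> \<not> ultimately_periodic x \<and>
      limsup (\<lambda>n. ereal (f (palindrome_complexity x n) / real (factor_complexity x n))) = \<infinity>"
    if not_O: "f \<notin> O[at_top](?g)"
  proof -
    have unb: "\<exists>t\<ge>T. f t > B * ?g t" for B T
    proof (rule ccontr)
      assume "\<not> (\<exists>t\<ge>T. f t > B * ?g t)"
      then have "\<forall>t\<ge>T. norm (f t) \<le> B * norm (?g t)"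
        using assms(2) by (simp add: not_less)
      then have "eventually (\<lambda>t. norm (f t) \<le> B * norm (?g t)) at_top"
        unfolding eventually_at_top_linorder by blast
      then show False using not_O bigoI by blast
    qed
    obtain X where "\<not> ultimately_periodic (char_word X)"
      "limsup (\<lambda>n. ereal (f (palindrome_complexity (char_word X) n) / real (factor_complexity (char_word X) n))) = \<infinity>"
      using ex_word_with_many_palindromes[OF assms(1) unb] by blast
    moreover have "finite {0, 1 :: nat}" "range (char_word X) \<subseteq> {0, 1}"
      by (auto simp: char_word_def)
    ultimately show ?thesis by blast
  qed
  have bounded: "bounded ((\<lambda>t. f t / ?g t) ` {t. t \<ge> 1})" if O: "f \<in> O[at_top](?g)"
  proof -
    obtain c T where cT: "\<And>t. t \<ge> T \<Longrightarrow> f t \<le> c * ?g t" using bigO[OF O] by blast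
    have "(\<lambda>t. f t / ?g t) ` {t. t \<ge> 1} \<subseteq> (\<lambda>t. f t / ?g t) ` {..<T} \<union> {0..c}"
    proof clarify
      fix t :: nat assume t: "t \<ge> 1" "f t / ?g t \<notin> {0..c}"
      have "?g t > 0" using t(1) by simp
      then have "\<not> t \<ge> T" using cT[of t] t(2) assms(2) by (auto simp: pos_divide_le_eq)
      then show "f t / ?g t \<in> (\<lambda>t. f t / ?g t) ` {..<T}" by simp
    qed
    moreover have "bounded ((\<lambda>t. f t / ?g t) ` {..<T} \<union> {0..c})"
      by (simp add: finite_imp_bounded)
    ultimately show ?thesis using bounded_subset by blast
  qed
  have "f \<in> O[at_top](?g)"
    if all: "\<forall>(A :: nat set) (x :: nat \<Rightarrow> nat). finite A \<longrightarrow> range x \<subseteq> A \<longrightarrow> \<not> ultimately_periodic x \<longrightarrow>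
      (\<lambda>n. f (palindrome_complexity x n) / real (factor_complexity x n)) \<longlonglongrightarrow> 0"
  proof (rule ccontr)
    assume "f \<notin> O[at_top](?g)"
    from large[OF this] obtain A and x :: "nat \<Rightarrow> nat" where x: "finite A" "range x \<subseteq> A" "\<not> ultimately_periodic x"
      and limsup: "limsup (\<lambda>n. ereal (f (palindrome_complexity x n) / real (factor_complexity x n))) = \<infinity>"
      by blast
    have "(\<lambda>n. f (palindrome_complexity x n) / real (factor_complexity x n)) \<longlonglongrightarrow> 0"
      using all x by blast
    then have "(\<lambda>n. ereal (f (palindrome_complexity x n) / real (factor_complexity x n))) \<longlonglongrightarrow> ereal 0"
      by (rule tendsto_ereal)
    then have "limsup (\<lambda>n. ereal (f (palindrome_complexity x n) / real (factor_complexity x n))) = ereal 0"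
      by (intro lim_imp_Limsup) simp
    with limsup show False by simp
  qed
  then show ?thesis using small large bounded by blast
qed

end
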